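(* For every fixed integer $d \geq 2$ there exists a constant $c = c(d) > 0$ such that for all integers $n \geq 1$, $$\mathrm{OT}_d(n) \leq \mathrm{twr}_d(c\,n).$$ Equivalently, $\mathrm{OT}_d(n) \le \mathrm{twr}_d(O(n))$, where $d$ is fixed and the implied constant depends only on $d$.
   Context: A point set (or sequence of points) in $\mathbb{R}^d$ is in general position if no $d+1$ of its members lie on a common hyperplane and, for each $1 \leq i \leq d$, no two of its members share the same $i$-th coordinate. Let $P = (p_1,\dots,p_N)$ be a sequence of points in $\mathbb{R}^d$ in general position. For $i_1 < i_2 < \cdots < i_{d+1}$, the orientation of the $(d+1)$-tuple $(p_{i_1},\dots,p_{i_{d+1}})$ is the sign ($+1$ or $-1$) of the determinant of the unique linear map sending $p_{i_2}-p_{i_1},\, p_{i_3}-p_{i_1},\dots,p_{i_{d+1}}-p_{i_1}$ to the standard basis $e_1,\dots,e_d$; equivalently, it is the sign of the determinant of the $d\times d$ matrix with columns $p_{i_2}-p_{i_1},\dots,p_{i_{d+1}}-p_{i_1}$. A point sequence in $\mathbb{R}^d$ is order-type homogeneous if all of its $(d+1)$-tuples (taken with indices in increasing order) have the same orientation. $\mathrm{OT}_d(n)$ is the smallest integer $N$ such that every $N$-element point sequence in $\mathbb{R}^d$ in general position contains an $n$-element subsequence that is order-type homogeneous. The tower function $\mathrm{twr}_k(x)$ is defined by $\mathrm{twr}_1(x) = x$ and $\mathrm{twr}_{i+1}(x) = 2^{\mathrm{twr}_i(x)}$. *)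

theory Defs
  imports
    "Jordan_Normal_Form.Determinant"
    "HOL-Library.Sublist"
    "HOL-Library.Ramsey"
begin

text \<open>
  The dimension is a natural number, so points of \<open>d\<close>-space are vectors in
  \<^term>\<open>carrier_vec d :: real vec set\<close>. A point sequence is a list; \<open>d + 1\<close> of its members
  with increasing indices form a \<^const>\<open>subseq\<close> of length \<open>d + 1\<close>.
\<close>

definition is_hyperplane :: "nat \<Rightarrow> real vec set \<Rightarrow> bool" where
  "is_hyperplane d H \<longleftrightarrow>
     (\<exists>a \<in> carrier_vec d. \<exists>b. a \<noteq> 0\<^sub>v d \<and> H = {x \<in> carrier_vec d. a \<bullet> x = b})"

definition general_position :: "nat \<Rightarrow> real vec list \<Rightarrow> bool" where
  "general_position d ps \<longleftrightarrow>
     set ps \<subseteq> carrier_vec d \<and>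
     (\<forall>ts. subseq ts ps \<and> length ts = d + 1 \<longrightarrow> \<not> (\<exists>H. is_hyperplane d H \<and> set ts \<subseteq> H)) \<and>
     (\<forall>i<d. distinct (map (\<lambda>p. p $ i) ps))"

text \<open>
  The matrix has columns \<open>p\<^sub>2 - p\<^sub>1, \<dots>, p\<^bsub>d+1\<^esub> - p\<^sub>1\<close>. On tuples
  from a sequence in general position the value is \<open>1\<close> or \<open>-1\<close>.
\<close>

definition orientation :: "nat \<Rightarrow> real vec list \<Rightarrow> real" where
  "orientation d ts = sgn (det (mat_of_cols d (map (\<lambda>p. p - hd ts) (tl ts))))"

definition order_type_homogeneous :: "nat \<Rightarrow> real vec list \<Rightarrow> bool" where
  "order_type_homogeneous d ps \<longleftrightarrow>
     (\<forall>ts us. subseq ts ps \<and> length ts = d + 1 \<and> subseq us ps \<and> length us = d + 1 \<longrightarrow>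
        orientation d ts = orientation d us)"

definition OT_arrows :: "nat \<Rightarrow> nat \<Rightarrow> nat \<Rightarrow> bool" where
  "OT_arrows d n N \<longleftrightarrow>
     (\<forall>ps. general_position d ps \<and> length ps = N \<longrightarrow>
        (\<exists>qs. subseq qs ps \<and> length qs = n \<and> order_type_homogeneous d qs))"

definition OT :: "nat \<Rightarrow> nat \<Rightarrow> nat" where
  "OT d n = (LEAST N. OT_arrows d n N)"

text \<open>
  By Ramsey's theorem some \<open>N\<close> qualifies, so the minimum in \<^const>\<open>OT\<close> is attained.
\<close>

lemma OT_arrows_exists: "\<exists>N. OT_arrows d n N"
proof -
  obtain N :: nat where N: "partn_lst {..<N} [n, n, n] (d + 1)"
    using ramsey_full by blast
  have "\<exists>qs. subseq qs ps \<and> length qs = n \<and> order_type_homogeneous d qs"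
    if len: "length ps = N" for ps
  proof -
    define c where "c s = (if s = 0 then 0 else if s > 0 then 1 else 2 :: nat)" for s :: real
    define f where "f I = c (orientation d (nths ps I))" for I
    have c_sgn: "sgn x = sgn y" if "c (sgn x) = c (sgn y)" for x y
      using that by (auto simp: c_def sgn_if split: if_splits)
    have "f \<in> nsets {..<N} (d + 1) \<rightarrow> {..<length [n, n, n]}"
      by (auto simp: f_def c_def)
    then obtain i where "i < length [n, n, n]" "monochromatic {..<N} ([n, n, n] ! i) (d + 1) f i"
      using N unfolding partn_lst_def by blast
    then have "monochromatic {..<N} n (d + 1) f i"
      by (auto simp: less_Suc_eq numeral_2_eq_2)
    then obtain H where H: "H \<in> nsets {..<N} n" and mono: "f ` nsets H (d + 1) \<subseteq> {i}"
      unfolding monochromatic_def by blast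
    have HN: "H \<subseteq> {..<N}" "finite H" "card H = n"
      using H by (auto simp: nsets_def)
    have colour: "c (orientation d ts) = i"
      if "subseq ts (nths ps H)" "length ts = d + 1" for ts
    proof -
      obtain B where ts: "ts = nths (nths ps H) B"
        using \<open>subseq ts (nths ps H)\<close> by (auto simp: subseq_conv_nths)
      define J where "J = {i \<in> H. \<exists>j\<in>B. card {i' \<in> H. i' < i} = j}"
      have J: "J \<subseteq> H" "ts = nths ps J"
        unfolding J_def by (auto simp only: ts nths_nths)
      have "{i. i < length ps \<and> i \<in> J} = J"
        using J HN len by auto
      then have "card J = d + 1"
        using \<open>length ts = d + 1\<close> J(2) length_nths[of ps J] by simp
      then have "J \<in> nsets H (d + 1)"
        using J(1) HN(2) finite_subset[of J H] by (simp add: nsets_def)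
      then show ?thesis
        using mono J(2) by (auto simp: f_def)
    qed
    have "order_type_homogeneous d (nths ps H)"
      unfolding order_type_homogeneous_def
    proof (intro allI impI, elim conjE)
      fix ts us
      assume "subseq ts (nths ps H)" "length ts = d + 1" "subseq us (nths ps H)" "length us = d + 1"
      then have "c (orientation d ts) = c (orientation d us)"
        by (simp only: colour)
      then show "orientation d ts = orientation d us"
        unfolding orientation_def by (rule c_sgn)
    qed
    moreover have "{i. i < length ps \<and> i \<in> H} = H"
      using HN len by auto
    then have "length (nths ps H) = n"
      using HN by (simp add: length_nths)
    ultimately show ?thesis
      using subseq_conv_nths by blast
  qed
  then show ?thesis
    unfolding OT_arrows_def by blast
qed

text \<open>The tower function is indexed from \<open>1\<close>; its value at index \<open>0\<close> is unspecified.\<close>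

fun twr :: "nat \<Rightarrow> real \<Rightarrow> real" where
  "twr (Suc 0) x = x"
| "twr (Suc (Suc k)) x = 2 powr twr (Suc k) x"

end

theory Submission
  imports Defs
begin

text \<open>
  Lift a point \<open>p\<close> of \<open>d\<close>-space to the vector \<open>(1, p)\<close>; the orientation of \<open>d + 1\<close> points becomes
  the sign of the determinant of the lifted vectors, and the statement becomes one about sequences
  of vectors in which \<open>k\<close>-tuples, completed by a fixed tail \<open>Q\<close> of vectors, have nonzero determinant.
  This is proved by induction on \<open>k\<close>. For the step, the greedy Erdos-Rado argument gives a sequence
  of length \<open>M\<close> in which the sign of a \<open>(k + 1)\<close>-tuple does not depend on its last member. Since \<open>m\<close>
  linear functionals on a space of dimension \<open>D\<close> realise at most \<open>(m + 1)^D\<close> sign patterns without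
  zeros, this costs only \<open>2^O(M^2)\<close> vectors. Replacing the last member by the last vector \<open>q\<close> of
  the sequence and moving \<open>q\<close> to the tail (projection from \<open>q\<close>) reduces \<open>k + 1\<close> to \<open>k\<close>, so each step
  adds one exponential. For \<open>k = 3\<close>, the three-term Grassmann-Pluecker relation makes the signs
  transitive on a suitable subsequence of polynomial size, and the cups-caps argument yields
  the exponential bound.
\<close>

subsection \<open>Sign patterns of linear functionals\<close>

text \<open>A sign vector without zeros is encoded by the set of its positive indices. These are the
  cells of the central arrangement given by the functionals.\<close>

definition sign_patterns :: "('i \<Rightarrow> 'j \<Rightarrow> real) \<Rightarrow> 'i set \<Rightarrow> 'j set \<Rightarrow> 'i set set" where
  "sign_patterns a I J =
     {{i \<in> I. (\<Sum>j\<in>J. a i j * x j) > 0} | x. \<forall>i\<in>I. (\<Sum>j\<in>J. a i j * x j) \<noteq> 0}"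

lemma finite_sign_patterns: "finite I \<Longrightarrow> finite (sign_patterns a I J)"
  by (rule finite_subset[of _ "Pow I"]) (auto simp: sign_patterns_def)

text \<open>
  Deletion and restriction: a pattern that extends in both ways across the hyperplane of the
  functional \<open>k\<close> is realised on that hyperplane, which is parametrised by one coordinate less.
\<close>

lemma sign_patterns_restrict:
  assumes J: "finite J" "j0 \<in> J" "a k j0 \<noteq> 0" and k: "k \<notin> I"
    and T: "T \<in> sign_patterns a (insert k I) J" "insert k T \<in> sign_patterns a (insert k I) J" "k \<notin> T"
  shows "T \<in> sign_patterns (\<lambda>i j. a i j - a i j0 / a k j0 * a k j) I (J - {j0})"
proof -
  define f where "f i x = (\<Sum>j\<in>J. a i j * x j)" for i x
  define a' where "a' i j = a i j - a i j0 / a k j0 * a k j" for i j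
  obtain x where x: "T = {i \<in> insert k I. f i x > 0}" "\<And>i. i \<in> insert k I \<Longrightarrow> f i x \<noteq> 0"
    using T(1) unfolding sign_patterns_def f_def by blast
  obtain y where y: "insert k T = {i \<in> insert k I. f i y > 0}" "\<And>i. i \<in> insert k I \<Longrightarrow> f i y \<noteq> 0"
    using T(2) unfolding sign_patterns_def f_def by blast
  have fx: "f k x < 0" using x T(3) by (auto simp: not_less_iff_gr_or_eq)
  have fy: "f k y > 0" using y by auto
  \<comment> \<open>A positive multiple of the point where the segment from \<open>x\<close> to
    \<open>y\<close> meets the hyperplane of \<open>k\<close>. Since
    \<open>f k x < 0 < f k y\<close>, both coefficients are positive, so \<open>u\<close> keeps
    every sign on which \<open>x\<close> and \<open>y\<close> agree.\<close>
  define u where "u j = f k y * x j - f k x * y j" for j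
  have fu: "f i u = f k y * f i x - f k x * f i y" for i
    unfolding f_def u_def right_diff_distrib sum_subtractf
    by (simp only: sum_distrib_left mult.left_commute)
  \<comment> \<open>On that hyperplane \<open>f i\<close> agrees with
    \<open>f i - a i j0 / a k j0 * f k\<close>, from which the coordinate \<open>j0\<close> has been
    eliminated.\<close>
  have restr: "(\<Sum>j\<in>J - {j0}. a' i j * u j) = f i u" for i
  proof -
    have "(\<Sum>j\<in>J - {j0}. a' i j * u j) = (\<Sum>j\<in>J. a' i j * u j)"
      using J by (simp add: sum.remove[of J j0] a'_def)
    also have "\<dots> = f i u - a i j0 / a k j0 * f k u"
      by (simp add: f_def a'_def sum_distrib_left sum_subtractf algebra_simps)
    also have "f k u = 0" by (simp add: fu)
    finally show ?thesis by simp
  qed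
  have pos: "f i u > 0 \<longleftrightarrow> i \<in> T" and nz: "f i u \<noteq> 0" if "i \<in> I" for i
  proof -
    have ik: "i \<noteq> k" using that k by auto
    have "(f i u > 0 \<longleftrightarrow> i \<in> T) \<and> f i u \<noteq> 0"
    proof (cases "i \<in> T")
      case True
      then have "f i x > 0" "f i y > 0" using x y ik by auto
      then have "f k y * f i x > 0" "f k x * f i y < 0"
        using fx fy by (auto intro: mult_neg_pos)
      then show ?thesis using True unfolding fu by auto
    next
      case False
      then have "\<not> f i x > 0" "\<not> f i y > 0" using x(1) y(1) ik that by auto
      then have "f i x < 0" "f i y < 0"
        using x(2)[of i] y(2)[of i] that by auto
      then have "f k y * f i x < 0" "f k x * f i y > 0"
        using fx fy by (auto intro: mult_pos_neg mult_neg_neg)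
      then show ?thesis using False unfolding fu by auto
    qed
    then show "f i u > 0 \<longleftrightarrow> i \<in> T" "f i u \<noteq> 0" by auto
  qed
  have "T = {i \<in> I. f i u > 0}"
    using pos T(3) x(1) by auto
  then show ?thesis
    unfolding sign_patterns_def a'_def[symmetric] mem_Collect_eq
    using nz restr by (intro exI[of _ u]) simp
qed

text \<open>Cells are counted by induction on the functionals: a new functional splits only the
  cells that its hyperplane cuts, and these are counted in one coordinate less. The bound survives
  because \<open>(m + 1)^D + (m + 1)^(D - 1) \<le> (m + 2)^D\<close> for
  \<open>D > 0\<close>.\<close>

lemma card_sign_patterns:
  assumes "finite I" "finite J"
  shows "card (sign_patterns a I J) \<le> (card I + 1) ^ card J"
  using assms
proof (induction I arbitrary: a J rule: finite_induct)
  case empty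
  have "sign_patterns a {} J \<subseteq> {{}}" by (auto simp: sign_patterns_def)
  then have "card (sign_patterns a {} J) \<le> card {{} :: 'a set}"
    by (intro card_mono) auto
  then show ?case by simp
next
  case (insert k I)
  show ?case
  proof (cases "\<forall>j\<in>J. a k j = 0")
    case True
    then have "sign_patterns a (insert k I) J = {}" by (simp add: sign_patterns_def)
    then show ?thesis by simp
  next
    case False
    then obtain j0 where j0: "j0 \<in> J" "a k j0 \<noteq> 0" by auto
    define S where "S = sign_patterns a (insert k I) J"
    define a' where "a' i j = a i j - a i j0 / a k j0 * a k j" for i j
    define n where "n = card (J - {j0})"
    have cardJ: "card J = Suc n" unfolding n_def using j0 insert by (intro card.remove) auto
    \<comment> \<open>\<open>A\<close> and \<open>B\<close> hold the patterns on \<open>I\<close>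
      that extend with \<open>k\<close> negative and with \<open>k\<close> positive. The union
      consists of restrictions to \<open>I\<close>, the intersection of patterns that extend both
      ways.\<close>
    define A where "A = {T \<in> S. k \<notin> T}"
    define B where "B = (\<lambda>T. T - {k}) ` {T \<in> S. k \<in> T}"
    have finS: "finite S" unfolding S_def using insert by (intro finite_sign_patterns) auto
    have fin: "finite A" "finite B" using finS by (auto simp: A_def B_def)
    have inj: "inj_on (\<lambda>T. T - {k}) {T \<in> S. k \<in> T}" by (auto simp: inj_on_def)
    have "card S = card A + card {T \<in> S. k \<in> T}"
      unfolding A_def using finS
      by (subst card_Un_disjoint[symmetric]) (auto intro: arg_cong[where f = card])
    also have "card {T \<in> S. k \<in> T} = card B"
      unfolding B_def by (rule card_image[OF inj, symmetric])
    also have "card A + card B = card (A \<union> B) + card (A \<inter> B)"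
      using fin by (rule card_Un_Int)
    also have "A \<union> B \<subseteq> sign_patterns a I J"
    proof -
      have "T - {k} \<in> sign_patterns a I J" if "T \<in> S" for T
      proof -
        obtain x where x: "T = {i \<in> insert k I. (\<Sum>j\<in>J. a i j * x j) > 0}"
          "\<forall>i\<in>insert k I. (\<Sum>j\<in>J. a i j * x j) \<noteq> 0"
          using \<open>T \<in> S\<close> unfolding S_def sign_patterns_def by blast
        then have "T - {k} = {i \<in> I. (\<Sum>j\<in>J. a i j * x j) > 0}" using insert.hyps by auto
        then show ?thesis using x(2) unfolding sign_patterns_def by blast
      qed
      moreover have "T = T - {k}" if "T \<in> A" for T using that by (auto simp: A_def)
      ultimately show ?thesis unfolding B_def using A_def by fastforce
    qed
    then have "card (A \<union> B) \<le> card (sign_patterns a I J)"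
      using insert by (intro card_mono finite_sign_patterns)
    also have "\<dots> \<le> (card I + 1) ^ card J" using insert by blast
    also have "A \<inter> B \<subseteq> sign_patterns a' I (J - {j0})"
    proof
      fix T assume "T \<in> A \<inter> B"
      then have "T \<in> S" "k \<notin> T" "insert k T \<in> S"
        by (auto simp: A_def B_def insert_absorb)
      then show "T \<in> sign_patterns a' I (J - {j0})"
        unfolding a'_def S_def using insert j0 by (intro sign_patterns_restrict) auto
    qed
    then have "card (A \<inter> B) \<le> card (sign_patterns a' I (J - {j0}))"
      using insert by (intro card_mono finite_sign_patterns)
    also have "\<dots> \<le> (card I + 1) ^ n" unfolding n_def using insert by blast
    also have "(card I + 1) ^ card J + (card I + 1) ^ n = (card I + 2) * (card I + 1) ^ n"
      by (simp add: cardJ)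
    also have "\<dots> \<le> (card I + 2) * (card I + 2) ^ n"
      by (intro mult_left_mono power_mono) auto
    also have "\<dots> = (card (insert k I) + 1) ^ card J"
      using insert by (simp add: cardJ)
    finally show ?thesis unfolding S_def by linarith
  qed
qed

lemma pigeonhole_filter:
  assumes "card (g ` set xs) \<le> b" "b > 0" "b * L \<le> length xs"
  shows "\<exists>c. L \<le> length (filter (\<lambda>x. g x = c) xs)"
proof (rule ccontr)
  assume "\<not> ?thesis"
  then have *: "length (filter (\<lambda>x. g x = c) xs) < L" for c by (auto simp: not_le)
  then have L: "L > 0" by (metis gr_zeroI less_zeroE)
  have "length xs = (\<Sum>c\<in>g ` set xs. length (filter (\<lambda>x. g x = c) xs))"
  proof -
    have "length ys = (\<Sum>c\<in>C. length (filter (\<lambda>x. g x = c) ys))"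
      if "finite C" "g ` set ys \<subseteq> C" for ys C
      using that(2)
    proof (induction ys)
      case (Cons y ys)
      have "(\<Sum>c\<in>C. length (filter (\<lambda>x. g x = c) (y # ys)))
          = (\<Sum>c\<in>C. length (filter (\<lambda>x. g x = c) ys) + (if g y = c then 1 else 0))"
        by (intro sum.cong) auto
      also have "\<dots> = length ys + 1"
        using Cons that(1) by (simp add: sum.distrib)
      finally show ?case by simp
    qed simp
    then show ?thesis by blast
  qed
  also have "\<dots> \<le> (\<Sum>c\<in>g ` set xs. L - 1)"
    using * by (intro sum_mono) (metis Suc_leI diff_Suc_1 diff_le_mono)
  also have "\<dots> \<le> b * (L - 1)" using assms(1) by simp
  also have "\<dots> < b * L" using assms(2) L by simp
  finally show False using assms(3) by simp
qed

subsection \<open>End-homogeneous subsequences\<close>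

text \<open>
  The Erdos-Rado argument, where the refinement only costs the number \<open>b\<close> of patterns that occur.
\<close>

lemma end_homogeneous_subseq:
  fixes \<chi> :: "'a list \<Rightarrow> 'a \<Rightarrow> bool"
  assumes pat: "\<And>ys zs. subseq (ys @ zs) vs \<Longrightarrow> length ys \<le> M \<Longrightarrow>
      card ((\<lambda>x. {t. subseq t ys \<and> length t = k \<and> \<chi> t x}) ` set zs) \<le> b"
    and k: "k > 0" and b: "b > 0" and len: "(b + 1) ^ M \<le> length vs"
  shows "\<exists>ys q. length ys = M \<and> subseq (ys @ [q]) vs \<and>
      (\<forall>ts x. length ts = k \<longrightarrow> subseq (ts @ [x]) ys \<longrightarrow> \<chi> ts x = \<chi> ts q)"
proof -
  \<comment> \<open>\<open>ys\<close> is the part chosen so far, \<open>zs\<close> the surviving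
    candidates. The invariants: no \<open>k\<close>-tuple of \<open>ys\<close> distinguishes two
    candidates, and none distinguishes a later chosen member from a candidate.\<close>
  have "\<exists>ys zs. length ys = m \<and> subseq (ys @ zs) vs \<and> (b + 1) ^ (M - m) \<le> length zs \<and>
      (\<forall>ts. \<forall>x\<in>set zs. \<forall>y\<in>set zs. length ts = k \<longrightarrow> subseq ts ys \<longrightarrow> \<chi> ts x = \<chi> ts y) \<and>
      (\<forall>ts x. \<forall>y\<in>set zs. length ts = k \<longrightarrow> subseq (ts @ [x]) ys \<longrightarrow> \<chi> ts x = \<chi> ts y)"
    if "m \<le> M" for m
    using that
  proof (induction m)
    case 0
    show ?case
      using k len by (intro exI[of _ "[]"] exI[of _ vs]) auto
  next
    case (Suc m)
    then have "m \<le> M" by simp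
    from Suc.IH[OF this] obtain ys zs where ys: "length ys = m" and sub: "subseq (ys @ zs) vs"
      and lz: "(b + 1) ^ (M - m) \<le> length zs"
      and I1: "\<And>ts x y. x \<in> set zs \<Longrightarrow> y \<in> set zs \<Longrightarrow> length ts = k \<Longrightarrow> subseq ts ys \<Longrightarrow> \<chi> ts x = \<chi> ts y"
      and I2: "\<And>ts x y. y \<in> set zs \<Longrightarrow> length ts = k \<Longrightarrow> subseq (ts @ [x]) ys \<Longrightarrow> \<chi> ts x = \<chi> ts y"
      by blast
    \<comment> \<open>Of at least \<open>(b + 1) * L\<close> candidates the first is moved to
      \<open>ys\<close>. The rest still number at least \<open>b * L\<close>, so some pattern class
      contains \<open>L\<close> of them.\<close>
    define L where "L = (b + 1) ^ (M - Suc m)"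
    have L: "(b + 1) ^ (M - m) = (b + 1) * L" "L > 0"
      using Suc.prems by (simp_all add: L_def Suc_diff_Suc flip: power_Suc)
    then obtain z zs' where z: "zs = z # zs'" using lz by (cases zs) auto
    define g where "g x = {t. subseq t (ys @ [z]) \<and> length t = k \<and> \<chi> t x}" for x
    have "card (g ` set zs') \<le> b"
      unfolding g_def using sub Suc.prems ys z by (intro pat) auto
    moreover have "b * L \<le> length zs'" using lz L z by auto
    ultimately obtain c where c: "L \<le> length (filter (\<lambda>x. g x = c) zs')"
      using b pigeonhole_filter by blast
    define ws where "ws = filter (\<lambda>x. g x = c) zs'"
    have ws: "set ws \<subseteq> set zs" "subseq ws zs'" by (auto simp: ws_def z)
    have same: "\<chi> ts x = \<chi> ts y"
      if "x \<in> set ws" "y \<in> set ws" "length ts = k" "subseq ts (ys @ [z])" for ts x y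
      using that unfolding ws_def g_def by auto
    \<comment> \<open>If the last member of the tuple is \<open>z\<close> itself, the first
      invariant applies, since \<open>z\<close> was a candidate up to this round.\<close>
    have later: "\<chi> ts x = \<chi> ts y"
      if "y \<in> set ws" "length ts = k" "subseq (ts @ [x]) (ys @ [z])" for ts x y
    proof (cases "subseq (ts @ [x]) ys")
      case True then show ?thesis using I2 that ws by blast
    next
      case False
      obtain us ws' where us: "ts @ [x] = us @ ws'" "subseq us ys" "subseq ws' [z]"
        using \<open>subseq (ts @ [x]) (ys @ [z])\<close> by (auto simp: subseq_append_iff)
      moreover from us(3) have "ws' = [] \<or> ws' = [z]"
        by (cases ws') (auto split: if_splits)
      ultimately have "x = z" "subseq ts ys" using False by auto
      then show ?thesis using I1[of z y ts] that ws z by auto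
    qed
    show ?case
    proof (intro exI conjI)
      show "length (ys @ [z]) = Suc m" using ys by simp
      have "subseq ((ys @ [z]) @ ws) (ys @ zs)" using ws(2) by (simp add: z subseq_append')
      then show "subseq ((ys @ [z]) @ ws) vs" using sub by (rule subseq_order.trans)
      show "(b + 1) ^ (M - Suc m) \<le> length ws" using c by (simp add: L_def ws_def)
      show "\<forall>ts. \<forall>x\<in>set ws. \<forall>y\<in>set ws. length ts = k \<longrightarrow> subseq ts (ys @ [z]) \<longrightarrow> \<chi> ts x = \<chi> ts y"
        using same by blast
      show "\<forall>ts x. \<forall>y\<in>set ws. length ts = k \<longrightarrow> subseq (ts @ [x]) (ys @ [z]) \<longrightarrow> \<chi> ts x = \<chi> ts y"
        using later by blast
    qed
  qed
  from this[of M] obtain ys zs where *: "length ys = M" "subseq (ys @ zs) vs" "1 \<le> length zs"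
    "\<forall>ts x. \<forall>y\<in>set zs. length ts = k \<longrightarrow> subseq (ts @ [x]) ys \<longrightarrow> \<chi> ts x = \<chi> ts y"
    by (metis diff_self_eq_0 order_refl power_0)
  then obtain q zs' where q: "zs = q # zs'" by (cases zs) auto
  have "subseq (ys @ [q]) (ys @ zs)" by (simp add: q subseq_append')
  then have "subseq (ys @ [q]) vs" using *(2) by (rule subseq_order.trans)
  then show ?thesis using * q by (intro exI[of _ ys] exI[of _ q]) auto
qed

subsection \<open>Transitive colourings of pairs and triples\<close>

definition homogeneous_pairs :: "('a::linorder \<Rightarrow> 'a \<Rightarrow> bool) \<Rightarrow> bool \<Rightarrow> 'a set \<Rightarrow> bool" where
  "homogeneous_pairs \<chi> s S \<longleftrightarrow> (\<forall>a\<in>S. \<forall>b\<in>S. a < b \<longrightarrow> \<chi> a b = s)"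

definition homogeneous_triples :: "('a::linorder \<Rightarrow> 'a \<Rightarrow> 'a \<Rightarrow> bool) \<Rightarrow> bool \<Rightarrow> 'a set \<Rightarrow> bool" where
  "homogeneous_triples \<chi> s S \<longleftrightarrow> (\<forall>a\<in>S. \<forall>b\<in>S. \<forall>c\<in>S. a < b \<longrightarrow> b < c \<longrightarrow> \<chi> a b c = s)"

text \<open>The Erdos-Szekeres argument for monotone subsequences. Let \<open>E\<close> be the set
  of last members of True chains of size \<open>k\<close>. If \<open>E\<close> has \<open>l\<close>
  members, either they form a False chain, or some True pair \<open>e < f\<close> in
  \<open>E\<close> lets \<open>f\<close> prolong a chain ending in \<open>e\<close>. Otherwise
  \<open>V - E\<close> is large enough for induction and contains no True chain of size
  \<open>k\<close>, as its maximum would lie in \<open>E\<close>.\<close>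

lemma transitive_pairs_homogeneous:
  fixes \<chi> :: "'a::linorder \<Rightarrow> 'a \<Rightarrow> bool"
  assumes "finite V"
    and tr: "\<And>s a b c. a \<in> V \<Longrightarrow> b \<in> V \<Longrightarrow> c \<in> V \<Longrightarrow> a < b \<Longrightarrow> b < c \<Longrightarrow>
               \<chi> a b = s \<Longrightarrow> \<chi> b c = s \<Longrightarrow> \<chi> a c = s"
    and "k * l \<le> card V"
  shows "\<exists>S\<subseteq>V. card S = k \<and> homogeneous_pairs \<chi> True S \<or> card S = l \<and> homogeneous_pairs \<chi> False S"
  using assms
proof (induction k arbitrary: V)
  case 0
  show ?case by (intro exI[of _ "{}"]) (auto simp: homogeneous_pairs_def)
next
  case (Suc k)
  show ?case
  proof (cases "k = 0 \<or> l = 0")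
    case True
    show ?thesis
    proof (cases "l = 0")
      case True
      then show ?thesis by (intro exI[of _ "{}"]) (auto simp: homogeneous_pairs_def)
    next
      case False
      then obtain v where "v \<in> V" using Suc.prems(3) by fastforce
      then show ?thesis using \<open>k = 0 \<or> l = 0\<close> False
        by (intro exI[of _ "{v}"]) (auto simp: homogeneous_pairs_def)
    qed
  next
    case False
    define E where "E = {e \<in> V. \<exists>S\<subseteq>V. card S = k \<and> homogeneous_pairs \<chi> True S \<and> e \<in> S \<and> (\<forall>b\<in>S. b \<le> e)}"
    show ?thesis
    proof (cases "l \<le> card E")
      case True
      then obtain S where S: "S \<subseteq> E" "card S = l" by (meson obtain_subset_with_card_n)
      show ?thesis
      proof (cases "homogeneous_pairs \<chi> False S")
        case True
        then show ?thesis using S unfolding E_def by blast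
      next
        case False
        then obtain e f where ef: "e \<in> S" "f \<in> S" "e < f" "\<chi> e f"
          unfolding homogeneous_pairs_def by blast
        then obtain R where R: "R \<subseteq> V" "card R = k" "homogeneous_pairs \<chi> True R" "e \<in> R" "\<And>b. b \<in> R \<Longrightarrow> b \<le> e"
        proof -
          from S ef have "e \<in> E" by auto
          then show ?thesis using that unfolding E_def by blast
        qed
        have V: "e \<in> V" "f \<in> V" using S ef by (auto simp: E_def)
        have lt: "b < f" if "b \<in> R" for b using R(5)[OF that] ef by auto
        have "\<chi> b f" if "b \<in> R" for b
        proof (cases "b = e")
          case False
          then have "b < e" using R(5)[OF that] by auto
          then have "\<chi> b e" using R that unfolding homogeneous_pairs_def by blast
          then show ?thesis using tr[of b e f True] Suc.prems(2)[of b e f True] \<open>b < e\<close> ef V R that by auto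
        qed (use ef in auto)
        then have "homogeneous_pairs \<chi> True (insert f R)"
          using R(3) lt unfolding homogeneous_pairs_def by (auto dest: less_asym)
        moreover have "finite R" using R(1) Suc.prems(1) finite_subset by blast
        then have "card (insert f R) = Suc k" using R(2) lt by (subst card_insert_disjoint) auto
        ultimately show ?thesis using R V by (intro exI[of _ "insert f R"]) auto
      qed
    next
      case less: False
      have "card (V - E) = card V - card E"
        using Suc.prems(1) by (intro card_Diff_subset) (auto simp: E_def)
      then have "k * l \<le> card (V - E)" using less Suc.prems(3) by auto
      then obtain S where S: "S \<subseteq> V - E"
        "card S = k \<and> homogeneous_pairs \<chi> True S \<or> card S = l \<and> homogeneous_pairs \<chi> False S"
        using Suc.IH[of "V - E"] Suc.prems by (metis DiffD1 finite_Diff)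
      show ?thesis
      proof (cases "card S = k \<and> homogeneous_pairs \<chi> True S")
        case True
        then have "finite S" "S \<noteq> {}" using False by (auto intro: card_ge_0_finite)
        then have max: "Max S \<in> S" "\<forall>b\<in>S. b \<le> Max S" by auto
        moreover have "S \<subseteq> V" using S(1) by auto
        ultimately have "Max S \<in> E" unfolding E_def using True by blast
        then show ?thesis using S(1) max by auto
      qed (use S in blast)
    qed
  qed
qed

text \<open>The triple of the two last members \<open>x\<close>, \<open>e\<close> with the new
  vertex \<open>y\<close> decides everything: transitivity carries its colour first to all
  \<open>(b, e, y)\<close> and then to all \<open>(a, b, y)\<close>.\<close>

lemma homogeneous_triples_insert_right:
  fixes \<chi> :: "'a::linorder \<Rightarrow> 'a \<Rightarrow> 'a \<Rightarrow> bool"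
  assumes tr: "\<And>a b c d. a \<in> V \<Longrightarrow> b \<in> V \<Longrightarrow> c \<in> V \<Longrightarrow> d \<in> V \<Longrightarrow> a < b \<Longrightarrow> b < c \<Longrightarrow> c < d \<Longrightarrow>
               \<chi> a b c = s \<Longrightarrow> \<chi> b c d = s \<Longrightarrow> \<chi> a b d = s \<and> \<chi> a c d = s"
    and S: "S \<subseteq> V" "homogeneous_triples \<chi> s S" "e \<in> S" "\<And>b. b \<in> S \<Longrightarrow> b \<le> e"
    and x: "x \<in> S" "x < e" "\<And>b. b \<in> S \<Longrightarrow> b < e \<Longrightarrow> b \<le> x"
    and y: "y \<in> V" "e < y" "\<chi> x e y = s"
  shows "homogeneous_triples \<chi> s (insert y S)"
proof -
  have lt: "b < y" if "b \<in> S" for b using S(4)[OF that] y by auto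
  have last: "\<chi> b e y = s" if "b \<in> S" "b < e" for b
  proof (cases "b = x")
    case False
    then have "b < x" using x(3)[OF that] by auto
    moreover from this have "\<chi> b x e = s" using S that x unfolding homogeneous_triples_def by blast
    ultimately show ?thesis using tr[of b x e y] S x y that by blast
  qed (use y in auto)
  have "\<chi> a b y = s" if "a \<in> S" "b \<in> S" "a < b" for a b
  proof (cases "b = e")
    case False
    then have "b < e" using S(4)[OF that(2)] by auto
    moreover from this have "\<chi> a b e = s" using S that unfolding homogeneous_triples_def by blast
    ultimately show ?thesis using tr[of a b e y] last[of b] S y that by blast
  qed (use last that in auto)
  moreover have "b \<in> S" if "b \<in> insert y S" "b < c" "c \<in> insert y S" for b c
    using that lt[of c] by auto
  moreover have "\<chi> a b c = s" if "a \<in> S" "b \<in> S" "c \<in> S" "a < b" "b < c" for a b c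
    using S(2) that unfolding homogeneous_triples_def by blast
  ultimately show ?thesis unfolding homogeneous_triples_def by (metis insertE)
qed

text \<open>The mirror image, with the two first members \<open>e\<close>, \<open>y\<close> and a
  new vertex \<open>x\<close> in front.\<close>

lemma homogeneous_triples_insert_left:
  fixes \<chi> :: "'a::linorder \<Rightarrow> 'a \<Rightarrow> 'a \<Rightarrow> bool"
  assumes tr: "\<And>a b c d. a \<in> V \<Longrightarrow> b \<in> V \<Longrightarrow> c \<in> V \<Longrightarrow> d \<in> V \<Longrightarrow> a < b \<Longrightarrow> b < c \<Longrightarrow> c < d \<Longrightarrow>
               \<chi> a b c = s \<Longrightarrow> \<chi> b c d = s \<Longrightarrow> \<chi> a b d = s \<and> \<chi> a c d = s"
    and S: "S \<subseteq> V" "homogeneous_triples \<chi> s S" "e \<in> S" "\<And>b. b \<in> S \<Longrightarrow> e \<le> b"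
    and y: "y \<in> S" "e < y" "\<And>b. b \<in> S \<Longrightarrow> e < b \<Longrightarrow> y \<le> b"
    and x: "x \<in> V" "x < e" "\<chi> x e y = s"
  shows "homogeneous_triples \<chi> s (insert x S)"
proof -
  have lt: "x < b" if "b \<in> S" for b using S(4)[OF that] x by auto
  have first: "\<chi> x e b = s" if "b \<in> S" "e < b" for b
  proof (cases "b = y")
    case False
    then have "y < b" using y(3)[OF that] by auto
    moreover from this have "\<chi> e y b = s" using S that y unfolding homogeneous_triples_def by blast
    ultimately show ?thesis using tr[of x e y b] S x y that by blast
  qed (use x in auto)
  have "\<chi> x a b = s" if "a \<in> S" "b \<in> S" "a < b" for a b
  proof (cases "a = e")
    case False
    then have "e < a" using S(4)[OF that(1)] by auto
    moreover from this have "\<chi> e a b = s" using S that unfolding homogeneous_triples_def by blast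
    ultimately show ?thesis using tr[of x e a b] first[of a] S x that by blast
  qed (use first that in auto)
  moreover have "c \<in> S" if "c \<in> insert x S" "b < c" "b \<in> insert x S" for b c
    using that lt[of b] by auto
  moreover have "\<chi> a b c = s" if "a \<in> S" "b \<in> S" "c \<in> S" "a < b" "b < c" for a b c
    using S(2) that unfolding homogeneous_triples_def by blast
  ultimately show ?thesis unfolding homogeneous_triples_def by (metis insertE)
qed

section \<open>The cups-caps theorem for transitive colourings of triples\<close>

text \<open>Call True sets cups and False sets caps, and let \<open>E\<close> be the set of right
  ends of cups of size \<open>k - 1\<close>. One of \<open>E\<close> and \<open>V - E\<close> keeps
  half of the vertices. Inside \<open>V - E\<close> there is no cup of size \<open>k - 1\<close>, so
  induction gives a cap of size \<open>l\<close>. Inside \<open>E\<close> induction gives a cup of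
  size \<open>k\<close> or a cap of size \<open>l - 1\<close>; the left end \<open>e\<close> of such
  a cap is the right end of a cup of size \<open>k - 1\<close>, and the triple around
  \<open>e\<close> prolongs one of the two.\<close>

lemma cups_caps:
  fixes \<chi> :: "'a::linorder \<Rightarrow> 'a \<Rightarrow> 'a \<Rightarrow> bool"
  assumes "finite V"
    and "\<And>s a b c d. a \<in> V \<Longrightarrow> b \<in> V \<Longrightarrow> c \<in> V \<Longrightarrow> d \<in> V \<Longrightarrow> a < b \<Longrightarrow> b < c \<Longrightarrow> c < d \<Longrightarrow>
               \<chi> a b c = s \<Longrightarrow> \<chi> b c d = s \<Longrightarrow> \<chi> a b d = s \<and> \<chi> a c d = s"
    and "2 ^ (k + l) \<le> card V"
  shows "\<exists>S\<subseteq>V. card S = k \<and> homogeneous_triples \<chi> True S \<or> card S = l \<and> homogeneous_triples \<chi> False S"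
  using assms
proof (induction "k + l" arbitrary: k l V rule: less_induct)
  case less
  note fin = less.prems(1) and tr = less.prems(2)
  have small: "homogeneous_triples \<chi> s S" if "card S \<le> 2" "finite S" for s S
  proof -
    have False if abc: "a \<in> S" "b \<in> S" "c \<in> S" "a < b" "b < c" for a b c
    proof -
      have "card {a, b, c} \<le> card S" using abc \<open>finite S\<close> by (intro card_mono) auto
      moreover have "card {a, b, c} = 3" using abc by (auto simp: card_insert_if)
      ultimately show False using \<open>card S \<le> 2\<close> by simp
    qed
    then show ?thesis unfolding homogeneous_triples_def by blast
  qed
  have card: "k + l \<le> card V" using less.prems(3) less_exp[of "k + l"] by linarith
  show ?case
  proof (cases "k \<le> 2 \<or> l \<le> 2")
    case True
    obtain S where "S \<subseteq> V" "card S = (if k \<le> 2 then k else l)"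
      using card by (metis add_leD1 add_leD2 obtain_subset_with_card_n)
    then show ?thesis
      using True small[of S] fin finite_subset[of S V] by (intro exI[of _ S]) (auto split: if_splits)
  next
    case False
    \<comment> \<open>Sizes of at least 2 guarantee that the common end \<open>e\<close> has a
      predecessor \<open>x\<close> in the cup and a successor \<open>y\<close> in the cap.\<close>
    then obtain k' l' where kl: "k = Suc k'" "l = Suc l'" "k' \<ge> 2" "l' \<ge> 2"
      by (cases k; cases l) auto
    define E where "E = {e \<in> V. \<exists>S\<subseteq>V. card S = k' \<and> homogeneous_triples \<chi> True S \<and> e \<in> S \<and> (\<forall>b\<in>S. b \<le> e)}"
    have EV: "E \<subseteq> V" by (auto simp: E_def)
    have "card (V - E) = card V - card E"
      using fin EV by (intro card_Diff_subset) (auto intro: finite_subset)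
    moreover have "2 ^ (k + l) = 2 * (2::nat) ^ (k' + l)" "k + l' = k' + l" using kl by simp_all
    ultimately consider "2 ^ (k + l') \<le> card E" | "2 ^ (k' + l) \<le> card (V - E)"
      using less.prems(3) by fastforce
    then show ?thesis
    proof cases
      case 1
      have "\<exists>S\<subseteq>E. card S = k \<and> homogeneous_triples \<chi> True S \<or> card S = l' \<and> homogeneous_triples \<chi> False S"
      proof (rule less.hyps)
        show "finite E" using fin EV finite_subset by blast
        show "\<chi> a b d = s \<and> \<chi> a c d = s"
          if "a \<in> E" "b \<in> E" "c \<in> E" "d \<in> E" "a < b" "b < c" "c < d" "\<chi> a b c = s" "\<chi> b c d = s"
          for s a b c d using tr[of a b c d s] that EV by blast
      qed (use 1 kl in auto)
      then obtain S where S: "S \<subseteq> E"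
        "card S = k \<and> homogeneous_triples \<chi> True S \<or> card S = l' \<and> homogeneous_triples \<chi> False S"
        by blast
      show ?thesis
      proof (cases "card S = k \<and> homogeneous_triples \<chi> True S")
        case True
        then show ?thesis using S EV by blast
      next
        case False
        then have cap: "card S = l'" "homogeneous_triples \<chi> False S" using S by auto
        then have finS: "finite S" "S \<noteq> {}" using kl by (auto intro: card_ge_0_finite)
        define e where "e = Min S"
        have e: "e \<in> S" "\<And>b. b \<in> S \<Longrightarrow> e \<le> b" using finS by (auto simp: e_def)
        obtain R where R: "R \<subseteq> V" "card R = k'" "homogeneous_triples \<chi> True R" "e \<in> R" "\<And>b. b \<in> R \<Longrightarrow> b \<le> e"
        proof -
          from S e have "e \<in> E" by auto
          then show ?thesis using that unfolding E_def by blast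
        qed
        have finR: "finite R" using R(1) fin finite_subset by blast
        have "card (S - {e}) > 0" "card (R - {e}) > 0" using cap kl e R finS finR by auto
        then have ne: "S - {e} \<noteq> {}" "R - {e} \<noteq> {}" by force+
        define y where "y = Min (S - {e})"
        define x where "x = Max (R - {e})"
        have y: "y \<in> S" "y \<noteq> e" "\<And>b. b \<in> S \<Longrightarrow> e < b \<Longrightarrow> y \<le> b"
          using Min_in[of "S - {e}"] ne finS by (auto simp: y_def)
        have x: "x \<in> R" "x \<noteq> e" "\<And>b. b \<in> R \<Longrightarrow> b < e \<Longrightarrow> b \<le> x"
          using Max_in[of "R - {e}"] ne finR by (auto simp: x_def)
        have ey: "e < y" and xe: "x < e" using e(2)[OF y(1)] R(5)[OF x(1)] x y by auto
        have SV: "S \<subseteq> V" using S EV by auto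
        show ?thesis
        proof (cases "\<chi> x e y")
          case True
          have "homogeneous_triples \<chi> True (insert y R)"
            by (rule homogeneous_triples_insert_right[where V = V and e = e and x = x])
              (use tr R x y xe ey SV True in auto)
          moreover have "y \<notin> R" using R(5) ey by force
          ultimately show ?thesis using R finR kl SV y by (intro exI[of _ "insert y R"]) auto
        next
          case False
          have "homogeneous_triples \<chi> False (insert x S)"
            by (rule homogeneous_triples_insert_left[where V = V and e = e and y = y])
              (use tr cap e x y xe ey SV R False in auto)
          moreover have "x \<notin> S" using e(2) xe by force
          ultimately show ?thesis using R finS cap kl SV x by (intro exI[of _ "insert x S"]) auto
        qed
      qed
    next
      case 2
      have "\<exists>S\<subseteq>V - E. card S = k' \<and> homogeneous_triples \<chi> True S \<or> card S = l \<and> homogeneous_triples \<chi> False S"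
      proof (rule less.hyps)
        show "\<chi> a b d = s \<and> \<chi> a c d = s"
          if "a \<in> V - E" "b \<in> V - E" "c \<in> V - E" "d \<in> V - E" "a < b" "b < c" "c < d" "\<chi> a b c = s" "\<chi> b c d = s"
          for s a b c d using tr[of a b c d s] that by blast
      qed (use 2 kl fin in auto)
      then obtain S where S: "S \<subseteq> V - E"
        "card S = k' \<and> homogeneous_triples \<chi> True S \<or> card S = l \<and> homogeneous_triples \<chi> False S"
        by blast
      show ?thesis
      proof (cases "card S = k' \<and> homogeneous_triples \<chi> True S")
        case True
        then have "finite S" "S \<noteq> {}" using kl by (auto intro: card_ge_0_finite)
        then have max: "Max S \<in> S" "\<forall>b\<in>S. b \<le> Max S" by auto
        moreover have "S \<subseteq> V" using S(1) by auto
        ultimately have "Max S \<in> E" unfolding E_def using True by blast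
        then show ?thesis using S(1) max by auto
      qed (use S in blast)
    qed
  qed
qed

subsection \<open>Brackets\<close>

definition bracket :: "nat \<Rightarrow> real vec list \<Rightarrow> real" where
  "bracket D vs = det (mat_of_cols D vs)"

lemma bracket_swap:
  assumes "length (xs @ x # y # zs) = D"
  shows "bracket D (xs @ x # y # zs) = - bracket D (xs @ y # x # zs)"
proof -
  have "mat_of_cols D (xs @ x # y # zs)
      = swapcols (length xs) (Suc (length xs)) (mat_of_cols D (xs @ y # x # zs))"
  proof (rule eq_matI)
    fix i j
    assume "i < dim_row (swapcols (length xs) (Suc (length xs)) (mat_of_cols D (xs @ y # x # zs)))"
      "j < dim_col (swapcols (length xs) (Suc (length xs)) (mat_of_cols D (xs @ y # x # zs)))"
    then have ij: "i < D" "j < D" using assms by auto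
    then show "mat_of_cols D (xs @ x # y # zs) $$ (i, j)
      = swapcols (length xs) (Suc (length xs)) (mat_of_cols D (xs @ y # x # zs)) $$ (i, j)"
      using assms by (auto simp: mat_of_cols_index nth_append nth_Cons' not_less)
  qed (use assms in auto)
  moreover have "mat_of_cols D (xs @ y # x # zs) \<in> carrier_mat D D"
    using assms by (intro carrier_matI) auto
  ultimately show ?thesis
    unfolding bracket_def using assms det_swapcols[of "length xs" D "Suc (length xs)"] by simp
qed

lemma bracket_linear:
  assumes "length xs + length zs + 1 = D"
  shows "\<exists>c. \<forall>x. bracket D (xs @ x # zs) = (\<Sum>i<D. c i * x $ i)"
proof -
  \<comment> \<open>The cofactors along a column do not depend on its entries, so the zero vector
    can hold the place of \<open>x\<close>.\<close>
  define c where "c i = cofactor (mat_of_cols D (xs @ 0\<^sub>v D # zs)) i (length xs)" for i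
  have "bracket D (xs @ x # zs) = (\<Sum>i<D. c i * x $ i)" for x
  proof -
    let ?A = "mat_of_cols D (xs @ x # zs)"
    have "?A \<in> carrier_mat D D" using assms by (intro carrier_matI) auto
    then have "bracket D (xs @ x # zs) = (\<Sum>i<D. ?A $$ (i, length xs) * cofactor ?A i (length xs))"
      unfolding bracket_def using assms by (intro laplace_expansion_column) auto
    also have "\<dots> = (\<Sum>i<D. c i * x $ i)"
    proof (rule sum.cong)
      fix i assume "i \<in> {..<D}"
      have "mat_delete ?A i (length xs) = mat_delete (mat_of_cols D (xs @ 0\<^sub>v D # zs)) i (length xs)"
        using assms \<open>i \<in> {..<D}\<close>
        by (intro eq_matI) (auto simp: mat_delete_def mat_of_cols_index nth_append nth_Cons')
      then show "?A $$ (i, length xs) * cofactor ?A i (length xs) = c i * x $ i"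
        using assms \<open>i \<in> {..<D}\<close>
        by (simp add: c_def cofactor_def mat_of_cols_index)
    qed simp
    finally show ?thesis .
  qed
  then show ?thesis by blast
qed

lemma bracket_not_distinct:
  assumes "length vs = D" "set vs \<subseteq> carrier_vec D" "\<not> distinct vs"
  shows "bracket D vs = 0"
proof -
  obtain i j where ij: "i < D" "j < D" "i \<noteq> j" "vs ! i = vs ! j"
    using assms by (auto simp: distinct_conv_nth)
  moreover have "vs ! i \<in> carrier_vec D" "vs ! j \<in> carrier_vec D"
    using assms ij by auto
  ultimately show ?thesis unfolding bracket_def
    using assms by (intro det_identical_columns[of _ D i j] carrier_matI) auto
qed

text \<open>As \<open>x\<close>, \<open>y\<close> and \<open>R\<close> form a basis,
  \<open>z\<close> can be expanded in it. The terms from \<open>R\<close> repeat a column and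
  vanish, so \<open>z\<close> acts in the brackets as a combination of \<open>x\<close> and
  \<open>y\<close>, and antisymmetry gives the relation.\<close>

lemma bracket_grassmann_pluecker:
  assumes D: "length R + 2 = D"
    and car: "set (x # y # z # w # R) \<subseteq> carrier_vec D"
    and nz: "bracket D (x # y # R) \<noteq> 0"
  shows "bracket D (x # y # R) * bracket D (z # w # R) - bracket D (x # z # R) * bracket D (y # w # R)
       + bracket D (x # w # R) * bracket D (y # z # R) = 0"
proof -
  define \<phi> where "\<phi> a b = bracket D (a # b # R)" for a b
  define vs where "vs = x # y # R"
  let ?A = "mat_of_cols D vs"
  have A: "?A \<in> carrier_mat D D" using D by (intro carrier_matI) (auto simp: vs_def)
  have z: "z \<in> carrier_vec D" using car by auto
  \<comment> \<open>Cramer's rule: the coordinates of \<open>z\<close> in the basis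
    \<open>vs\<close>.\<close>
  define c where "c = (1 / det ?A) \<cdot>\<^sub>v (adj_mat ?A *\<^sub>v z)"
  have cD: "c \<in> carrier_vec D"
    unfolding c_def using adj_mat(1)[OF A] z by (auto intro: mult_mat_vec_carrier)
  have "?A *\<^sub>v c = (1 / det ?A) \<cdot>\<^sub>v (?A *\<^sub>v (adj_mat ?A *\<^sub>v z))"
    unfolding c_def using A adj_mat(1)[OF A] z by (intro mult_mat_vec) auto
  also have "?A *\<^sub>v (adj_mat ?A *\<^sub>v z) = (?A * adj_mat ?A) *\<^sub>v z"
    using A adj_mat(1)[OF A] z by (simp add: assoc_mult_mat_vec)
  also have "\<dots> = det ?A \<cdot>\<^sub>v z"
    unfolding adj_mat(2)[OF A] using z by (intro eq_vecI) auto
  also have "(1 / det ?A) \<cdot>\<^sub>v (det ?A \<cdot>\<^sub>v z) = z"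
    using nz by (simp add: smult_smult_assoc bracket_def vs_def)
  finally have Ac: "?A *\<^sub>v c = z" .
  have zi: "z $ i = (\<Sum>j<D. c $ j * vs ! j $ i)" if "i < D" for i
  proof -
    have "z $ i = (?A *\<^sub>v c) $ i" by (simp add: Ac)
    also have "\<dots> = (\<Sum>j<D. c $ j * vs ! j $ i)"
      using that cD A D by (auto simp: scalar_prod_def vs_def mat_of_cols_index atLeast0LessThan mult.commute intro!: sum.cong)
    finally show ?thesis .
  qed
  have anti: "\<phi> a b = - \<phi> b a" for a b
    unfolding \<phi>_def using bracket_swap[of "[]" a b R D] D by simp
  have expand: "\<phi> z u = c $ 0 * \<phi> x u + c $ 1 * \<phi> y u" if "u \<in> carrier_vec D" for u
  proof -
    obtain k where k: "\<And>v. \<phi> v u = (\<Sum>i<D. k i * v $ i)"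
      using bracket_linear[of "[]" "u # R" D] D unfolding \<phi>_def by auto
    have "\<phi> z u = (\<Sum>i<D. \<Sum>j<D. c $ j * (k i * vs ! j $ i))"
      unfolding k using zi by (intro sum.cong) (auto simp: sum_distrib_left mult.left_commute)
    also have "\<dots> = (\<Sum>j<D. c $ j * \<phi> (vs ! j) u)"
      unfolding k by (subst sum.swap) (simp add: sum_distrib_left)
    also have "\<dots> = (\<Sum>j\<in>{0, 1}. c $ j * \<phi> (vs ! j) u)"
    proof (rule sum.mono_neutral_right)
      show "\<forall>j\<in>{..<D} - {0, 1}. c $ j * \<phi> (vs ! j) u = 0"
      proof
        fix j assume j: "j \<in> {..<D} - {0, 1}"
        then obtain i where i: "j = Suc (Suc i)" by (cases j rule: nat.exhaust; cases "j - 1") auto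
        then have "vs ! j = R ! i" "i < length R" using j D by (auto simp: vs_def)
        then have "vs ! j \<in> set R" by simp
        then have "\<phi> (vs ! j) u = 0"
          unfolding \<phi>_def using D car that by (intro bracket_not_distinct) auto
        then show "c $ j * \<phi> (vs ! j) u = 0" by simp
      qed
    qed (use D in auto)
    finally show ?thesis by (simp add: vs_def)
  qed
  have self: "\<phi> a a = 0" for a using anti[of a a] by simp
  have "\<phi> z x = c $ 1 * \<phi> y x" "\<phi> z y = c $ 0 * \<phi> x y" "\<phi> z w = c $ 0 * \<phi> x w + c $ 1 * \<phi> y w"
    using expand car by (auto simp: self)
  then have "\<phi> x y * \<phi> z w - \<phi> x z * \<phi> y w + \<phi> x w * \<phi> y z = 0"
    using anti[of x z] anti[of y z] anti[of y x] by (simp add: algebra_simps)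
  then show ?thesis unfolding \<phi>_def .
qed

section \<open>Orientations and general position in terms of lifted points\<close>

text \<open>Adding the first column \<open>(1, p)\<close> to the columns \<open>(0, q - p)\<close>
  yields the lifted points. \<open>U\<close> is this unimodular column operation and
  \<open>B\<close> is block triangular with the difference matrix as its corner.\<close>

lemma bracket_vCons_one:
  assumes len: "length ts = Suc d" and car: "set ts \<subseteq> carrier_vec d"
  shows "bracket (Suc d) (map (vCons 1) ts) = det (mat_of_cols d (map (\<lambda>p. p - hd ts) (tl ts)))"
proof -
  obtain p qs where ts: "ts = p # qs" "length qs = d" using len by (cases ts) auto
  define Df where "Df = mat_of_cols d (map (\<lambda>q. q - p) qs)"
  have Df: "Df \<in> carrier_mat d d" unfolding Df_def using ts by (intro carrier_matI) auto
  define B where "B = four_block_mat (1\<^sub>m 1) (0\<^sub>m 1 d) (mat_of_cols d [p]) Df"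
  define U where "U = four_block_mat (1\<^sub>m 1) (mat 1 d (\<lambda>_. 1 :: real)) (0\<^sub>m d 1) (1\<^sub>m d)"
  have p: "mat_of_cols d [p] \<in> carrier_mat d 1" by (intro carrier_matI) auto
  have B: "B \<in> carrier_mat (1 + d) (1 + d)" unfolding B_def using Df by (intro four_block_carrier_mat) auto
  have U: "U \<in> carrier_mat (1 + d) (1 + d)" unfolding U_def by (intro four_block_carrier_mat) auto
  have detB: "det B = det Df"
    unfolding B_def using p Df by (subst det_four_block_mat_upper_right_zero[of _ 1 _ d]) auto
  have detU: "det U = 1"
    unfolding U_def by (subst det_four_block_mat_lower_left_zero[of _ 1 _ d]) auto
  have BU: "B * U = four_block_mat (1\<^sub>m 1) (mat 1 d (\<lambda>_. 1)) (mat_of_cols d [p])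
      (mat_of_cols d [p] * mat 1 d (\<lambda>_. 1) + Df)"
    unfolding B_def U_def using p Df
    by (subst mult_four_block_mat[of _ 1 1 _ d _ d _ _ 1 _ d]) auto
  have "mat_of_cols (Suc d) (map (vCons 1) ts) = B * U"
    unfolding BU
  proof (rule eq_matI)
    fix i j
    assume "i < dim_row (four_block_mat (1\<^sub>m 1) (mat 1 d (\<lambda>_. 1)) (mat_of_cols d [p])
        (mat_of_cols d [p] * mat 1 d (\<lambda>_. 1) + Df))"
      "j < dim_col (four_block_mat (1\<^sub>m 1) (mat 1 d (\<lambda>_. 1)) (mat_of_cols d [p])
        (mat_of_cols d [p] * mat 1 d (\<lambda>_. 1) + Df))"
    then have ij: "i < Suc d" "j < Suc d" using Df by auto
    have qs: "qs ! k $ l - p $ l = (qs ! k - p) $ l" if "k < d" "l < d" for k l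
      using car that ts nth_mem[of k qs] by auto
    show "mat_of_cols (Suc d) (map (vCons 1) ts) $$ (i, j) =
      four_block_mat (1\<^sub>m 1) (mat 1 d (\<lambda>_. 1)) (mat_of_cols d [p])
        (mat_of_cols d [p] * mat 1 d (\<lambda>_. 1) + Df) $$ (i, j)"
      using ij ts Df car
      by (cases i; cases j)
        (auto simp: mat_of_cols_index Df_def scalar_prod_def simp flip: qs)
  qed (use ts Df in auto)
  then show ?thesis
    unfolding bracket_def using det_mult[OF B U] detB detU by (simp add: ts Df_def)
qed

text \<open>A kernel vector \<open>(b, a)\<close> of the transposed matrix is an affine equation
  \<open>b + a \<bullet> p = 0\<close> satisfied by all the points.\<close>

lemma bracket_vCons_one_nonzero:
  assumes len: "length ts = Suc d" and car: "set ts \<subseteq> carrier_vec d"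
    and hyp: "\<not> (\<exists>H. is_hyperplane d H \<and> set ts \<subseteq> H)"
  shows "bracket (Suc d) (map (vCons 1) ts) \<noteq> 0"
proof
  define A where "A = mat_of_cols (Suc d) (map (vCons 1) ts)"
  have A: "A \<in> carrier_mat (Suc d) (Suc d)" unfolding A_def using len by (intro carrier_matI) auto
  assume "bracket (Suc d) (map (vCons 1) ts) = 0"
  then have "det (A\<^sup>T) = 0" using det_transpose[OF A] by (simp add: bracket_def A_def)
  then obtain v where v: "v \<in> carrier_vec (Suc d)" "v \<noteq> 0\<^sub>v (Suc d)" "A\<^sup>T *\<^sub>v v = 0\<^sub>v (Suc d)"
    using det_0_iff_vec_prod_zero[of "A\<^sup>T" "Suc d"] A by auto
  obtain b a where ba: "v = vCons b a" "a \<in> carrier_vec d"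
    using v(1) by (cases v) auto
  have eq: "b + a \<bullet> p = 0" if p: "p \<in> set ts" for p
  proof -
    obtain i where "i < length ts" "ts ! i = p" using p by (meson in_set_conv_nth)
    then have i: "i < Suc d" "ts ! i = p" using len by auto
    have pd: "p \<in> carrier_vec d" using p car by auto
    have "(A\<^sup>T *\<^sub>v v) $ i = vCons 1 p \<bullet> v"
      using i A len pd by (simp add: A_def)
    moreover have "vCons 1 p \<bullet> v = b + a \<bullet> p"
      using ba pd by (simp add: comm_scalar_prod[of a d p])
    ultimately show ?thesis using v(3) i by simp
  qed
  \<comment> \<open>If \<open>a\<close> vanished, the equation at one point would give
    \<open>b = 0\<close> and hence \<open>v = 0\<close>.\<close>
  have "a \<noteq> 0\<^sub>v d"
  proof
    assume a: "a = 0\<^sub>v d"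
    have "hd ts \<in> set ts" using len by (cases ts) auto
    then have "b = 0" using eq[of "hd ts"] a car by auto
    then show False using v(2) a ba by (simp add: zero_vec_Suc)
  qed
  then have "is_hyperplane d {x \<in> carrier_vec d. a \<bullet> x = - b}"
    unfolding is_hyperplane_def using ba by blast
  moreover have "set ts \<subseteq> {x \<in> carrier_vec d. a \<bullet> x = - b}"
    using eq car by (force simp: eq_neg_iff_add_eq_0 add.commute)
  ultimately show False using hyp by blast
qed

subsection \<open>Homogeneous sequences of vectors\<close>

lemma subseq_mapE:
  assumes "subseq ts (map f xs)"
  obtains us where "subseq us xs" "ts = map f us"
  using assms by (auto simp: subseq_conv_nths nths_map)

lemma set_subseq: "subseq xs ys \<Longrightarrow> set xs \<subseteq> set ys"
  by (auto simp: subseq_conv_nths dest: in_set_nthsD)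

lemma sorted_wrt_subseq: "subseq xs ys \<Longrightarrow> sorted_wrt P ys \<Longrightarrow> sorted_wrt P xs"
  by (induction rule: list_emb.induct) (auto dest: set_subseq)

text \<open>The way a three-term relation yields transitivity: \<open>p\<close>, \<open>q\<close>,
  \<open>r\<close> are brackets already known to share a sign, so \<open>x\<close> inherits the
  common sign of \<open>y\<close> and \<open>z\<close>.\<close>

lemma sum_same_sign:
  fixes p q r x y z :: real
  assumes eq: "p * x = q * y + r * z"
    and p: "p \<noteq> 0" "q \<noteq> 0" "r \<noteq> 0" "(p > 0) = s" "(q > 0) = s" "(r > 0) = s"
    and yz: "y \<noteq> 0" "z \<noteq> 0" "(y > 0) = s'" "(z > 0) = s'"
  shows "(x > 0) = s'"
proof -
  have *: "(x > 0) = s'" if "p * x = q * y + r * z" "p > 0" "q > 0" "r > 0" for p q r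
  proof (cases s')
    case True
    then have "q * y > 0" "r * z > 0" using that yz by auto
    then have "p * x > 0" using that by linarith
    then have "x > 0" using \<open>p > 0\<close> by (rule zero_less_mult_pos)
    then show ?thesis using True by simp
  next
    case False
    then have "q * y < 0" "r * z < 0" using that yz by (auto intro!: mult_pos_neg)
    then have "p * x < p * 0" using that by linarith
    then have "x < 0" using \<open>p > 0\<close> by (simp only: mult_less_cancel_left_pos)
    then show ?thesis using False by simp
  qed
  show ?thesis
  proof (cases s)
    case True
    then show ?thesis using * eq p by blast
  next
    case False
    then have "- p > 0" "- q > 0" "- r > 0" using p by auto
    moreover have "- p * x = - q * y + - r * z" using eq by simp
    ultimately show ?thesis using * by blast
  qed
qed

text \<open>
  Appending \<open>Q\<close> amounts to projecting along the span of \<open>Q\<close>, so that the dimension \<open>D\<close> stays fixed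
  while the size \<open>k\<close> of the tuples varies.
\<close>

definition sign_arrows :: "nat \<Rightarrow> nat \<Rightarrow> nat \<Rightarrow> nat \<Rightarrow> bool" where
  "sign_arrows D k n N \<longleftrightarrow>
     (\<forall>Q vs. length Q + k = D \<and> set Q \<subseteq> carrier_vec D \<and> set vs \<subseteq> carrier_vec D \<and> N \<le> length vs \<and>
        (\<forall>ts. subseq ts vs \<and> length ts = k \<longrightarrow> bracket D (ts @ Q) \<noteq> 0) \<longrightarrow>
        (\<exists>ws s. subseq ws vs \<and> length ws = n \<and>
           (\<forall>ts. subseq ts ws \<and> length ts = k \<longrightarrow> (bracket D (ts @ Q) > 0) = s)))"

section \<open>The base case of triples\<close>

lemma sign_arrows_three:
  assumes n: "n \<ge> 1"
  shows "sign_arrows D 3 n (64 ^ n)"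
  unfolding sign_arrows_def
proof (intro allI impI, elim conjE)
  fix Q vs
  assume Q: "length Q + 3 = D" "set Q \<subseteq> carrier_vec D" and vs: "set vs \<subseteq> carrier_vec D"
    and len: "64 ^ n \<le> length vs"
    and nondeg: "\<forall>ts. subseq ts vs \<and> length ts = 3 \<longrightarrow> bracket D (ts @ Q) \<noteq> 0"
  define N where "N = length vs"
  define T where "T i j l = bracket D (vs ! i # vs ! j # vs ! l # Q)" for i j l
  have sub: "subseq (map ((!) vs) is) vs" if "sorted_wrt (<) is" "set is \<subseteq> {..<N}" for "is"
  proof -
    have "subseq is [0..<N]"
      using that by (intro sorted_subset_imp_subseq) auto
    then have "subseq (map ((!) vs) is) (map ((!) vs) [0..<N])" by (rule subseq_map)
    then show ?thesis by (simp add: N_def map_nth)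
  qed
  have nz: "T i j l \<noteq> 0" if "i < j" "j < l" "l < N" for i j l
    using nondeg sub[of "[i, j, l]"] that by (auto simp: T_def)
  have swap: "T i j l = - T j i l" "T i j l = - T i l j" for i j l
    unfolding T_def using bracket_swap[of "[]" "vs ! i" "vs ! j" "vs ! l # Q" D]
      bracket_swap[of "[vs ! i]" "vs ! j" "vs ! l" Q D] Q by auto
  \<comment> \<open>The relation for the four vectors \<open>i\<close>, \<open>j\<close>,
    \<open>k\<close>, \<open>l\<close> after projection from \<open>m\<close>.\<close>
  have gp: "T i j m * T k l m - T i k m * T j l m + T i l m * T j k m = 0"
    if "T i j m \<noteq> 0" "i < N" "j < N" "k < N" "l < N" "m < N" for i j k l m
    using bracket_grassmann_pluecker[of "vs ! m # Q" D "vs ! i" "vs ! j" "vs ! k" "vs ! l"]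
      that Q vs unfolding T_def N_def by (auto simp: subset_iff)
  txt \<open>
    After projection from the vectors \<open>0\<close> and \<open>1\<close> only the signs \<open>f\<close> remain, after projection from
    the vector \<open>0\<close> the signs \<open>h\<close> of pairs. Constancy of \<open>f\<close> makes \<open>h\<close> transitive, and constancy of
    \<open>h\<close> makes \<open>T\<close> transitive.
  \<close>
  define f where "f i = T 0 1 i" for i
  define h where "h i j = T 0 i j" for i j
  \<comment> \<open>The vectors \<open>0\<close> and \<open>1\<close> are set aside, and the
    majority sign of \<open>f\<close> costs a factor 2. The remaining
    \<open>16^n = 4^n * 4^n\<close> vectors allow for a homogeneous set of pairs of size
    \<open>4^n = 2^(n + n)\<close>, as the cups-caps argument requires.\<close>
  have len': "2 + 2 * 16 ^ n \<le> N"
  proof -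
    have "(4::nat) ^ 1 \<le> 4 ^ n" using n by (intro power_increasing) auto
    then have "4 * 16 ^ n \<le> (4::nat) ^ n * 16 ^ n" by (intro mult_right_mono) auto
    moreover have "1 \<le> (16::nat) ^ n" by simp
    ultimately have "2 + 2 * 16 ^ n \<le> (4::nat) ^ n * 16 ^ n" by linarith
    also have "\<dots> = 64 ^ n" by (simp flip: power_mult_distrib)
    finally show ?thesis using len N_def by simp
  qed
  have "\<exists>s. 16 ^ n \<le> card {i \<in> {2..<N}. (f i > 0) = s}"
  proof (rule ccontr)
    assume "\<not> ?thesis"
    then have "card {i \<in> {2..<N}. (f i > 0) = True} < 16 ^ n"
      "card {i \<in> {2..<N}. (f i > 0) = False} < 16 ^ n"
      by (auto simp only: not_ex not_le)
    moreover have "{2..<N} = {i \<in> {2..<N}. (f i > 0) = True} \<union> {i \<in> {2..<N}. (f i > 0) = False}"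
      by auto
    then have "card {2..<N} \<le> card {i \<in> {2..<N}. (f i > 0) = True} + card {i \<in> {2..<N}. (f i > 0) = False}"
      by (metis card_Un_le)
    ultimately show False using len' by simp
  qed
  then obtain s1 where s1: "16 ^ n \<le> card {i \<in> {2..<N}. (f i > 0) = s1}" by blast
  define V where "V = {i \<in> {2..<N}. (f i > 0) = s1}"
  have V: "2 \<le> i" "i < N" "(f i > 0) = s1" "f i \<noteq> 0" if "i \<in> V" for i
    using that nz[of 0 1 i] by (auto simp: V_def f_def)
  have hnz: "h i j \<noteq> 0" if "i \<in> V" "j \<in> V" "i < j" for i j
    using nz[of 0 i j] V[OF that(1)] V[OF that(2)] that by (auto simp: h_def)
  have "\<exists>S\<subseteq>V. card S = 4 ^ n \<and> homogeneous_pairs (\<lambda>i j. h i j > 0) True S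
      \<or> card S = 4 ^ n \<and> homogeneous_pairs (\<lambda>i j. h i j > 0) False S"
  proof (rule transitive_pairs_homogeneous)
    show "finite V" by (simp add: V_def)
    show "4 ^ n * 4 ^ n \<le> card V" using s1 by (simp add: V_def flip: power_mult_distrib)
    fix s a b c
    assume abc: "a \<in> V" "b \<in> V" "c \<in> V" "a < b" "b < c" "(h a b > 0) = s" "(h b c > 0) = s"
    \<comment> \<open>The relation for \<open>1\<close>, \<open>a\<close>, \<open>b\<close>,
      \<open>c\<close> projected from \<open>0\<close>; the swaps only sort the indices.\<close>
    have "f b * h a c = f a * h b c + f c * h a b"
      using gp[of 1 a 0 b c] nz[of 0 1 a] V[OF abc(1)] V[OF abc(2)] V[OF abc(3)]
        swap(1)[of 1 0 a] swap(2)[of 1 a 0] swap(1)[of b 0 c] swap(2)[of b c 0]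
        swap(1)[of 1 0 b] swap(2)[of 1 b 0] swap(1)[of a 0 c] swap(2)[of a c 0]
        swap(1)[of 1 0 c] swap(2)[of 1 c 0] swap(1)[of a 0 b] swap(2)[of a b 0]
      unfolding f_def h_def by auto
    then show "(h a c > 0) = s"
      by (rule sum_same_sign[where s = s1]) (use abc V hnz in auto)
  qed
  then obtain S s2 where S: "S \<subseteq> V" "card S = 4 ^ n" "homogeneous_pairs (\<lambda>i j. h i j > 0) s2 S"
    by blast
  have h: "h i j \<noteq> 0" "(h i j > 0) = s2" if "i \<in> S" "j \<in> S" "i < j" for i j
    using S hnz that unfolding homogeneous_pairs_def by blast+
  have SN: "1 \<le> i" "i < N" if "i \<in> S" for i using V[of i] S that by auto
  have "\<exists>R\<subseteq>S. card R = n \<and> homogeneous_triples (\<lambda>i j l. T i j l > 0) True R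
      \<or> card R = n \<and> homogeneous_triples (\<lambda>i j l. T i j l > 0) False R"
  proof (rule cups_caps)
    show "finite S" using S(1) by (rule finite_subset) (simp add: V_def)
    have "(4::nat) ^ n = 2 ^ (n + n)" by (simp add: power_add flip: power_mult_distrib)
    then show "2 ^ (n + n) \<le> card S" using S(2) by simp
    fix s a b c d
    assume abcd: "a \<in> S" "b \<in> S" "c \<in> S" "d \<in> S" "a < b" "b < c" "c < d"
      and sign: "(T a b c > 0) = s" "(T b c d > 0) = s"
    note bd = SN[OF abcd(1)] SN[OF abcd(2)] SN[OF abcd(3)] SN[OF abcd(4)]
    have nz': "T a b c \<noteq> 0" "T b c d \<noteq> 0" using nz abcd bd by auto
    \<comment> \<open>The relation for \<open>0\<close>, \<open>a\<close>, \<open>c\<close>,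
      \<open>d\<close> projected from \<open>b\<close>, with coefficients of the common sign
      \<open>s2\<close>.\<close>
    have "h b c * T a b d = h a b * T b c d + h b d * T a b c"
      using gp[of 0 a b c d] nz[of 0 a b] abcd bd
        swap(2)[of 0 c b] swap(2)[of 0 d b] swap(2)[of a c b] swap(2)[of a d b]
        swap(2)[of c d b] swap(1)[of c b d]
      unfolding h_def by auto
    then have "(T a b d > 0) = s"
      by (rule sum_same_sign[where s = s2]) (use abcd h nz' sign in auto)
    \<comment> \<open>The relation for \<open>0\<close>, \<open>a\<close>, \<open>b\<close>,
      \<open>d\<close> projected from \<open>c\<close>.\<close>
    moreover have "h b c * T a c d = h a c * T b c d + h c d * T a b c"
      using gp[of 0 a c b d] nz[of 0 a c] abcd bd
        swap(2)[of 0 d c] swap(2)[of a d c] swap(2)[of b d c]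
      unfolding h_def by auto
    then have "(T a c d > 0) = s"
      by (rule sum_same_sign[where s = s2]) (use abcd h nz' sign in auto)
    ultimately show "(T a b d > 0) = s \<and> (T a c d > 0) = s" by blast
  qed
  then obtain R s where R: "R \<subseteq> S" "card R = n" "homogeneous_triples (\<lambda>i j l. T i j l > 0) s R"
    by blast
  have finR: "finite R" using n R(2) by (intro card_ge_0_finite) simp
  define rs where "rs = sorted_list_of_set R"
  have rs: "sorted_wrt (<) rs" "set rs = R" "length rs = n"
    using finR R(2) by (auto simp: rs_def)
  show "\<exists>ws s. subseq ws vs \<and> length ws = n \<and>
           (\<forall>ts. subseq ts ws \<and> length ts = 3 \<longrightarrow> (bracket D (ts @ Q) > 0) = s)"
  proof (intro exI conjI allI impI)
    show "subseq (map ((!) vs) rs) vs" using rs SN R(1) by (intro sub) auto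
    show "length (map ((!) vs) rs) = n" using rs by simp
    fix ts assume ts: "subseq ts (map ((!) vs) rs) \<and> length ts = 3"
    then obtain js where js: "subseq js rs" "ts = map ((!) vs) js" by (auto elim: subseq_mapE)
    then have "length js = 3" using ts by simp
    then obtain i j l where ijl: "js = [i, j, l]"
      by (auto simp: numeral_3_eq_3 length_Suc_conv)
    have "sorted_wrt (<) js" using js rs sorted_wrt_subseq by blast
    moreover have "set js \<subseteq> R" using js rs set_subseq by blast
    ultimately have "(T i j l > 0) = s"
      using R(3) unfolding homogeneous_triples_def ijl by auto
    then show "(bracket D (ts @ Q) > 0) = s" by (simp add: T_def js ijl)
  qed
qed

section \<open>The induction step from \<open>k\<close> to \<open>k + 1\<close>\<close>

lemma power_plus_one_le: "k > 0 \<Longrightarrow> (m::nat) ^ k + 1 \<le> (m + 1) ^ k"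
proof (induction k)
  case (Suc k)
  have "m * m ^ k \<le> m * (m + 1) ^ k" by (intro mult_left_mono power_mono) auto
  moreover have "1 \<le> (m + 1) ^ k" by simp
  ultimately have "m * m ^ k + 1 \<le> m * (m + 1) ^ k + (m + 1) ^ k" by linarith
  then show ?case by simp
qed simp

text \<open>Each \<open>k\<close>-tuple \<open>t\<close> of \<open>ys\<close> defines a linear
  functional of \<open>x\<close>, so at most \<open>M^k\<close> functionals in \<open>D\<close>
  coordinates are involved. Candidates in \<open>zs\<close> come after \<open>ys\<close>, so
  nondegeneracy keeps all values nonzero.\<close>

lemma card_bracket_patterns:
  assumes D: "length Q + Suc k = D" and k: "k > 0"
    and sub: "subseq (ys @ zs) vs" and M: "length ys \<le> M"
    and nondeg: "\<And>ts. subseq ts vs \<Longrightarrow> length ts = Suc k \<Longrightarrow> bracket D (ts @ Q) \<noteq> 0"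
  shows "card ((\<lambda>x. {t. subseq t ys \<and> length t = k \<and> bracket D (t @ x # Q) > 0}) ` set zs)
           \<le> (M + 1) ^ (k * D)"
proof -
  define T where "T = {t. subseq t ys \<and> length t = k}"
  have TL: "T \<subseteq> {t. set t \<subseteq> set ys \<and> length t = k}" by (auto simp: T_def dest: set_subseq)
  have finT: "finite T" using TL by (rule finite_subset) (simp add: finite_lists_length_eq)
  have "card T \<le> card {t. set t \<subseteq> set ys \<and> length t = k}"
    using TL by (intro card_mono) (simp_all add: finite_lists_length_eq)
  also have "\<dots> = card (set ys) ^ k" by (simp add: card_lists_length_eq)
  also have "\<dots> \<le> M ^ k" using card_length[of ys] M by (intro power_mono) auto
  finally have cardT: "card T + 1 \<le> (M + 1) ^ k" using power_plus_one_le[OF k, of M] by linarith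
  have "\<exists>c. \<forall>x. bracket D (t @ x # Q) = (\<Sum>i<D. c i * x $ i)" if "t \<in> T" for t
    using that D by (intro bracket_linear) (auto simp: T_def)
  then obtain c where c: "\<And>t x. t \<in> T \<Longrightarrow> bracket D (t @ x # Q) = (\<Sum>i<D. c t i * x $ i)"
    by metis
  have "(\<lambda>x. {t. subseq t ys \<and> length t = k \<and> bracket D (t @ x # Q) > 0}) ` set zs
      \<subseteq> sign_patterns c T {..<D}"
  proof (rule image_subsetI)
    fix x assume x: "x \<in> set zs"
    have "(\<Sum>i<D. c t i * x $ i) \<noteq> 0" if "t \<in> T" for t
    proof -
      have "subseq (t @ [x]) (ys @ zs)"
        using that x by (intro list_emb_append_mono) (auto simp: T_def subseq_singleton_left)
      then have "subseq (t @ [x]) vs" using sub by (rule subseq_order.trans)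
      then show ?thesis using nondeg[of "t @ [x]"] c[OF that, of x] that by (simp add: T_def)
    qed
    moreover have "{t. subseq t ys \<and> length t = k \<and> bracket D (t @ x # Q) > 0}
        = {t \<in> T. (\<Sum>i<D. c t i * x $ i) > 0}"
      using c by (auto simp: T_def)
    ultimately show "{t. subseq t ys \<and> length t = k \<and> bracket D (t @ x # Q) > 0} \<in> sign_patterns c T {..<D}"
      unfolding sign_patterns_def mem_Collect_eq by (intro exI[of _ "\<lambda>i. x $ i"]) simp
  qed
  then have "card ((\<lambda>x. {t. subseq t ys \<and> length t = k \<and> bracket D (t @ x # Q) > 0}) ` set zs)
      \<le> card (sign_patterns c T {..<D})"
    by (intro card_mono finite_sign_patterns finT)
  also have "\<dots> \<le> (card T + 1) ^ D" using card_sign_patterns[OF finT, of "{..<D}" c] by simp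
  also have "\<dots> \<le> ((M + 1) ^ k) ^ D" using cardT by (intro power_mono) auto
  finally show ?thesis by (simp add: power_mult)
qed

text \<open>Bounding \<open>M + 2\<close> by \<open>2^(M + 1)\<close> turns the cost of the
  refinement into a single exponential in \<open>M\<^sup>2\<close>.\<close>

lemma refinement_length:
  fixes M k :: nat
  assumes "k > 0"
  shows "((M + 1) ^ k + 1) ^ M \<le> 2 ^ (2 * k * M\<^sup>2)"
proof -
  have "(M + 1) ^ k + 1 \<le> (M + 2) ^ k" using power_plus_one_le[OF assms, of "M + 1"] by simp
  also have "M + 2 \<le> 2 ^ (M + 1)" using less_exp[of "M + 1"] by linarith
  then have "(M + 2) ^ k \<le> (2 ^ (M + 1)) ^ k" by (rule power_mono) simp
  finally have "((M + 1) ^ k + 1) ^ M \<le> ((2 ^ (M + 1)) ^ k) ^ M" by (rule power_mono) simp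
  also have "\<dots> = 2 ^ ((M + 1) * k * M)" by (simp only: power_mult)
  also have "\<dots> \<le> 2 ^ (2 * k * M\<^sup>2)"
  proof (rule power_increasing)
    have "M \<le> M * M" by (cases M) auto
    then have "k * (M + M * M) \<le> k * (2 * (M * M))" by (intro mult_left_mono) auto
    then show "(M + 1) * k * M \<le> 2 * k * M\<^sup>2" by (simp add: power2_eq_square algebra_simps)
  qed simp
  finally show ?thesis .
qed

lemma sign_arrows_Suc:
  assumes k: "k > 0" and arrow: "sign_arrows D k n M"
  shows "sign_arrows D (Suc k) n (2 ^ (2 * (k * D) * M\<^sup>2))"
  unfolding sign_arrows_def
proof (intro allI impI, elim conjE)
  fix Q vs
  assume Q: "length Q + Suc k = D" "set Q \<subseteq> carrier_vec D" and vs: "set vs \<subseteq> carrier_vec D"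
    and len: "2 ^ (2 * (k * D) * M\<^sup>2) \<le> length vs"
    and nondeg: "\<forall>ts. subseq ts vs \<and> length ts = Suc k \<longrightarrow> bracket D (ts @ Q) \<noteq> 0"
  have kD: "k * D > 0" using k Q(1) by auto
  define b where "b = (M + 1) ^ (k * D)"
  have "\<exists>ys q. length ys = M \<and> subseq (ys @ [q]) vs \<and>
      (\<forall>ts x. length ts = k \<longrightarrow> subseq (ts @ [x]) ys \<longrightarrow>
         (bracket D (ts @ x # Q) > 0) = (bracket D (ts @ q # Q) > 0))"
  proof (rule end_homogeneous_subseq)
    fix ys zs assume "subseq (ys @ zs) vs" "length ys \<le> M"
    then show "card ((\<lambda>x. {t. subseq t ys \<and> length t = k \<and> bracket D (t @ x # Q) > 0}) ` set zs) \<le> b"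
      unfolding b_def using Q k nondeg by (intro card_bracket_patterns) auto
  next
    show "(b + 1) ^ M \<le> length vs"
      unfolding b_def using refinement_length[OF kD, of M] len by linarith
  qed (use k in \<open>auto simp: b_def\<close>)
  then obtain ys q where ys: "length ys = M" and sub: "subseq (ys @ [q]) vs"
    and eq: "\<And>ts x. length ts = k \<Longrightarrow> subseq (ts @ [x]) ys \<Longrightarrow>
         (bracket D (ts @ x # Q) > 0) = (bracket D (ts @ q # Q) > 0)"
    by blast
  have "subseq ys (ys @ [q])" by (simp add: subseq_rev_drop_many)
  then have ysvs: "subseq ys vs" using sub by (rule subseq_order.trans)
  have "length (q # Q) + k = D" "set (q # Q) \<subseteq> carrier_vec D" "set ys \<subseteq> carrier_vec D" "M \<le> length ys"
    using Q vs set_subseq[OF sub] ys by auto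
  \<comment> \<open>Because \<open>q\<close> comes after all of \<open>ys\<close>, appending it to a
    \<open>k\<close>-tuple gives a \<open>(k + 1)\<close>-tuple of \<open>vs\<close>; nondegeneracy
    thus passes to the longer tail \<open>q # Q\<close>.\<close>
  moreover have "bracket D (ts @ q # Q) \<noteq> 0" if "subseq ts ys" "length ts = k" for ts
  proof -
    have "subseq (ts @ [q]) (ys @ [q])" using that by simp
    then have "subseq (ts @ [q]) vs" using sub by (rule subseq_order.trans)
    then show ?thesis using nondeg that by (auto dest: spec[of _ "ts @ [q]"])
  qed
  ultimately obtain ws s where ws: "subseq ws ys" "length ws = n"
    and s: "\<And>ts. subseq ts ws \<Longrightarrow> length ts = k \<Longrightarrow> (bracket D (ts @ q # Q) > 0) = s"
    using arrow unfolding sign_arrows_def by metis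
  have "(bracket D (us @ Q) > 0) = s" if us: "subseq us ws" "length us = Suc k" for us
  proof -
    obtain ts x where tx: "us = ts @ [x]" "length ts = k"
      using us(2) by (cases us rule: rev_cases) auto
    have "subseq (ts @ [x]) ys" using us(1) ws(1) tx subseq_order.trans by blast
    then have "(bracket D (us @ Q) > 0) = (bracket D (ts @ q # Q) > 0)"
      using eq tx by simp
    moreover have "subseq ts ws"
      using us(1) tx subseq_order.trans[of ts us ws] by (simp add: subseq_rev_drop_many)
    ultimately show ?thesis using s tx by blast
  qed
  then show "\<exists>ws s. subseq ws vs \<and> length ws = n \<and>
           (\<forall>ts. subseq ts ws \<and> length ts = Suc k \<longrightarrow> (bracket D (ts @ Q) > 0) = s)"
    using ws subseq_order.trans[OF ws(1) ysvs] by (intro exI[of _ ws] exI[of _ s]) simp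
qed

section \<open>Tower bounds\<close>

lemma twr_ge_1: "x \<ge> 1 \<Longrightarrow> twr (Suc i) x \<ge> 1"
proof (induction i)
  case (Suc i)
  then show ?case using ge_one_powr_ge_zero[of 2 "twr (Suc i) x"] by simp
qed simp

text \<open>A factor in front of a tower moves to its innermost argument:
  \<open>c * 2^y \<le> 2^(c * y)\<close> for \<open>y \<ge> 1\<close>, since
  \<open>c \<le> 2^(c - 1)\<close>.\<close>

lemma mult_twr_le:
  assumes "c \<ge> 1" "x \<ge> 1"
  shows "real c * twr (Suc i) x \<le> twr (Suc i) (real c * x)"
proof (induction i)
  case (Suc i)
  define y where "y = twr (Suc i) x"
  have y: "y \<ge> 1" unfolding y_def using assms by (intro twr_ge_1)
  have "c \<le> 2 ^ (c - 1)" using assms less_exp[of "c - 1"] by linarith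
  then have "real c \<le> real (2 ^ (c - 1))" by (simp only: of_nat_le_iff)
  also have "\<dots> = 2 powr (real c - 1)" using assms by (simp add: powr_realpow of_nat_diff flip: powr_realpow)
  also have "\<dots> \<le> 2 powr ((real c - 1) * y)"
    using y assms mult_left_mono[of 1 y "real c - 1"] by (intro powr_mono) auto
  finally have "real c * 2 powr y \<le> 2 powr ((real c - 1) * y) * 2 powr y"
    by (rule mult_right_mono) simp
  also have "\<dots> = 2 powr (real c * y)" by (simp flip: powr_add add: algebra_simps)
  also have "\<dots> \<le> 2 powr twr (Suc i) (real c * x)" using Suc y_def by (intro powr_mono) auto
  finally show ?case by (simp add: y_def)
qed simp

text \<open>At the top exponent the square contributes \<open>2 * y\<close> and the factor at most
  \<open>c * y\<close>; the resulting \<open>c + 2\<close> is then pushed inwards.\<close>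

lemma mult_twr_square_le:
  assumes "x \<ge> 1"
  shows "real c * (twr (Suc (Suc i)) x)\<^sup>2 \<le> twr (Suc (Suc i)) (real (c + 2) * x)"
proof -
  define y where "y = twr (Suc i) x"
  have y: "y \<ge> 1" unfolding y_def using assms by (intro twr_ge_1)
  have "real c \<le> 2 ^ c" using less_exp[of c] by (metis less_imp_le of_nat_le_iff of_nat_numeral of_nat_power)
  also have "\<dots> = 2 powr real c" by (simp add: powr_realpow)
  also have "\<dots> \<le> 2 powr (real c * y)"
    using y mult_left_mono[of 1 y "real c"] by (intro powr_mono) auto
  finally have "real c * (2 powr y)\<^sup>2 \<le> 2 powr (real c * y) * (2 powr y)\<^sup>2"
    by (rule mult_right_mono) simp
  also have "\<dots> = 2 powr (real (c + 2) * y)"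
    by (simp add: power2_eq_square algebra_simps flip: powr_add)
  also have "\<dots> \<le> 2 powr twr (Suc i) (real (c + 2) * x)"
    unfolding y_def using mult_twr_le[of "c + 2" x i] assms by (intro powr_mono) auto
  finally show ?thesis by (simp add: y_def)
qed

lemma sign_arrows_tower:
  "\<exists>c\<ge>1. \<forall>n\<ge>1. \<exists>N. sign_arrows D (j + 3) n N \<and> real N \<le> twr (j + 2) (real c * real n)"
proof (induction j)
  case 0
  \<comment> \<open>The constant 6 comes from \<open>64 = 2^6\<close>.\<close>
  have "real (64 ^ n) \<le> twr 2 (real 6 * real n)" for n
  proof -
    have "real (64 ^ n) = 2 ^ (6 * n)" by (simp add: power_mult)
    also have "\<dots> = 2 powr real (6 * n)" by (rule powr_realpow[symmetric]) simp
    finally show ?thesis by (simp add: numeral_2_eq_2)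
  qed
  then have "\<forall>n\<ge>1. \<exists>N. sign_arrows D (0 + 3) n N \<and> real N \<le> twr (0 + 2) (real 6 * real n)"
    using sign_arrows_three by (metis add_0)
  then show ?case by (intro exI[of _ 6]) simp
next
  case (Suc j)
  then obtain c where c: "c \<ge> 1"
    "\<And>n. n \<ge> 1 \<Longrightarrow> \<exists>M. sign_arrows D (j + 3) n M \<and> real M \<le> twr (j + 2) (real c * real n)"
    by blast
  \<comment> \<open>The coefficient of \<open>M\<^sup>2\<close> in the exponent of
    \<open>sign_arrows_Suc\<close> for tuples of size \<open>j + 3\<close>. It depends on
    \<open>j\<close> and \<open>D\<close> only, so the new constant \<open>(K + 2) * c\<close> is
    independent of \<open>n\<close>.\<close>
  define K where "K = 2 * ((j + 3) * D)"
  have "\<exists>N. sign_arrows D (Suc j + 3) n N \<and> real N \<le> twr (Suc j + 2) (real ((K + 2) * c) * real n)"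
    if n: "n \<ge> 1" for n
  proof -
    obtain M where M: "sign_arrows D (j + 3) n M" "real M \<le> twr (j + 2) (real c * real n)"
      using c n by blast
    have cn: "real c * real n \<ge> 1" using c(1) n mult_mono[of 1 "real c" 1 "real n"] by simp
    have "real (K * M\<^sup>2) = real K * (real M)\<^sup>2" by simp
    also have "\<dots> \<le> real K * (twr (j + 2) (real c * real n))\<^sup>2"
      using M(2) by (intro mult_left_mono power_mono) auto
    also have "\<dots> \<le> twr (j + 2) (real (K + 2) * (real c * real n))"
      using mult_twr_square_le[OF cn, of K j] by simp
    finally have "2 powr real (K * M\<^sup>2) \<le> 2 powr twr (j + 2) (real (K + 2) * (real c * real n))"
      by (intro powr_mono) auto
    also have "2 powr real (K * M\<^sup>2) = real (2 ^ (K * M\<^sup>2))" by (subst powr_realpow) auto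
    also have "2 powr twr (j + 2) (real (K + 2) * (real c * real n))
        = twr (Suc j + 2) (real ((K + 2) * c) * real n)"
      by (simp only: add_Suc add_2_eq_Suc' twr.simps of_nat_mult mult.assoc)
    finally have "real (2 ^ (K * M\<^sup>2)) \<le> twr (Suc j + 2) (real ((K + 2) * c) * real n)" .
    moreover have "sign_arrows D (Suc j + 3) n (2 ^ (K * M\<^sup>2))"
      using sign_arrows_Suc[OF _ M(1)] unfolding K_def by simp
    ultimately show ?thesis by blast
  qed
  moreover have "(K + 2) * c \<ge> 1" using c(1) by simp
  ultimately show ?case by blast
qed

section \<open>Return to order types\<close>

text \<open>Lifted points have dimension \<open>d + 1\<close>, equal to the tuple size, so the tail
  \<open>Q\<close> is empty. General position makes the brackets nonzero, so positivity alone
  determines the orientation.\<close>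

lemma OT_arrows_if_sign_arrows:
  assumes "sign_arrows (Suc d) (Suc d) n N"
  shows "OT_arrows d n N"
  unfolding OT_arrows_def
proof (intro allI impI, elim conjE)
  fix ps assume gp: "general_position d ps" and len: "length ps = N"
  have car: "set ps \<subseteq> carrier_vec d"
    and hyp: "\<And>ts. subseq ts ps \<Longrightarrow> length ts = Suc d \<Longrightarrow> \<not> (\<exists>H. is_hyperplane d H \<and> set ts \<subseteq> H)"
    using gp unfolding general_position_def by auto
  define vs where "vs = map (vCons 1) ps"
  have nz: "bracket (Suc d) (map (vCons 1) ts) \<noteq> 0" if "subseq ts ps" "length ts = Suc d" for ts
    using that hyp car set_subseq[OF that(1)] by (intro bracket_vCons_one_nonzero) auto
  have "set vs \<subseteq> carrier_vec (Suc d)" "N \<le> length vs" using car len by (auto simp: vs_def)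
  moreover have "bracket (Suc d) (ts @ []) \<noteq> 0" if "subseq ts vs" "length ts = Suc d" for ts
    using that nz unfolding vs_def by (auto elim!: subseq_mapE)
  ultimately have "\<exists>ws s. subseq ws vs \<and> length ws = n \<and>
      (\<forall>ts. subseq ts ws \<and> length ts = Suc d \<longrightarrow> (bracket (Suc d) (ts @ []) > 0) = s)"
    by (intro assms[unfolded sign_arrows_def, rule_format]) auto
  then obtain ws s where ws: "subseq ws vs" "length ws = n"
    and s: "\<And>ts. subseq ts ws \<Longrightarrow> length ts = Suc d \<Longrightarrow> (bracket (Suc d) (ts @ []) > 0) = s"
    by blast
  obtain qs where qs: "subseq qs ps" "ws = map (vCons 1) qs"
    using ws(1) unfolding vs_def by (rule subseq_mapE)
  have "orientation d ts = (if s then 1 else - 1)" if ts: "subseq ts qs" "length ts = Suc d" for ts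
  proof -
    have sub: "subseq ts ps" using ts(1) qs(1) by (rule subseq_order.trans)
    have "orientation d ts = sgn (bracket (Suc d) (map (vCons 1) ts))"
      unfolding orientation_def using ts car set_subseq[OF sub] by (subst bracket_vCons_one) auto
    moreover have "(bracket (Suc d) (map (vCons 1) ts) > 0) = s"
      using s[of "map (vCons 1) ts"] ts qs(2) subseq_map by auto
    ultimately show ?thesis using nz[OF sub ts(2)] by (auto simp: sgn_if)
  qed
  then have "order_type_homogeneous d qs" unfolding order_type_homogeneous_def by simp
  then show "\<exists>qs. subseq qs ps \<and> length qs = n \<and> order_type_homogeneous d qs"
    using qs ws(2) by auto
qed

theorem theorem1p3:
  fixes d :: nat
  assumes "d \<ge> 2"
  shows "\<exists>c::real. c > 0 \<and> (\<forall>n::nat. n \<ge> 1 \<longrightarrow> real (OT d n) \<le> twr d (c * real n))"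
proof -
  \<comment> \<open>Tuples of size \<open>d + 1 = j + 3\<close> then match the tower height
    \<open>d = j + 2\<close>.\<close>
  obtain j where j: "d = j + 2" using assms by (metis add.commute le_Suc_ex)
  then have j': "Suc d = j + 3" by simp
  obtain c where c: "c \<ge> 1"
    "\<And>n. n \<ge> 1 \<Longrightarrow> \<exists>N. sign_arrows (Suc d) (Suc d) n N \<and> real N \<le> twr d (real c * real n)"
    using sign_arrows_tower[of "Suc d" j] unfolding j'[symmetric] j[symmetric] by blast
  have "real (OT d n) \<le> twr d (real c * real n)" if n: "n \<ge> 1" for n
  proof -
    obtain N where N: "sign_arrows (Suc d) (Suc d) n N" "real N \<le> twr d (real c * real n)"
      using c n by blast
    have "OT d n \<le> N"
      unfolding OT_def using N(1) by (intro Least_le OT_arrows_if_sign_arrows)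
    then show ?thesis using N(2) by linarith
  qed
  then show ?thesis using c(1) by (intro exI[of _ "real c"]) auto
qed

end
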